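(* Let $R$ be a proper $*$-ring and let $a,b\in R$ be weak core invertible with $ab=0=ba$ and $a^*b=0$. Then $(a+b)^{\boxplus}=a^{\boxplus}+b^{\boxplus}$ (that is, $a+b$ is weak core invertible with weak core inverse $a^{\boxplus}+b^{\boxplus}$).
   Context: A proper $*$-ring is a (not necessarily commutative) ring $R$ with unit $1\ne 0$ and an involution $r\mapsto r^*$ satisfying $(r^* )^*=r$, $(r+s)^*=r^*+s^*$, $(rs)^*=s^*r^*$, such that $r^*r=0$ implies $r=0$. An element $y\in R$ is a weak core inverse of $a\in R$ if for some positive integer $k$ one has $ya^{k+1}=a^k$, $ay^2=y$ and $(a^k)^*ay=(a^k)^*$. In a proper $*$-ring it is unique if it exists and is denoted $a^{\boxplus}$; $a$ is then called weak core invertible. *)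

theory Defs
  imports Main
begin

text \<open>Multiplication is not assumed commutative; \<open>ring_1\<close> includes \<open>0 \<noteq> 1\<close>.\<close>

class proper_star_ring = ring_1 +
  fixes star :: "'a \<Rightarrow> 'a"
  assumes star_star: "star (star r) = r"
    and star_add: "star (r + s) = star r + star s"
    and star_mult: "star (r * s) = star s * star r"
    and star_proper: "star r * r = 0 \<Longrightarrow> r = 0"

definition is_weak_core_inverse :: "'a::proper_star_ring \<Rightarrow> 'a \<Rightarrow> bool" where
  "is_weak_core_inverse a y \<longleftrightarrow>
     (\<exists>k::nat. k > 0 \<and> y * a ^ (k + 1) = a ^ k \<and> a * y\<^sup>2 = y \<and>
        star (a ^ k) * a * y = star (a ^ k))"

definition weak_core_invertible :: "'a::proper_star_ring \<Rightarrow> bool" where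
  "weak_core_invertible a \<longleftrightarrow> (\<exists>y. is_weak_core_inverse a y)"

text \<open>Meaningful only for weak core invertible elements; the description is then justified by
  \<open>is_weak_core_inverse_unique\<close> below.\<close>

definition weak_core_inverse :: "'a::proper_star_ring \<Rightarrow> 'a" where
  "weak_core_inverse a = (THE y. is_weak_core_inverse a y)"

lemma weak_core_power_right:
  fixes a y :: "'a::proper_star_ring"
  assumes "a * y\<^sup>2 = y"
  shows "a ^ n * y ^ (n + 1) = y"
proof (induction n)
  case 0
  show ?case by simp
next
  case (Suc n)
  have "y ^ (Suc n + 1) = y\<^sup>2 * y ^ n"
    by (simp only: power_add [symmetric]) simp
  then have "a ^ Suc n * y ^ (Suc n + 1) = a ^ n * (a * y\<^sup>2) * y ^ n"
    by (simp only: power_Suc2 mult.assoc)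
  also have "\<dots> = a ^ n * y ^ (n + 1)"
    by (simp add: assms mult.assoc)
  finally show ?case using Suc.IH by simp
qed

lemma weak_core_exponent_mono:
  fixes a y :: "'a::proper_star_ring"
  assumes "y * a ^ (k + 1) = a ^ k" and "star (a ^ k) * a * y = star (a ^ k)"
  shows "y * a ^ (k + m + 1) = a ^ (k + m) \<and> star (a ^ (k + m)) * a * y = star (a ^ (k + m))"
proof
  have "a ^ (k + m + 1) = a ^ (k + 1) * a ^ m"
    by (simp only: power_add [symmetric] ac_simps)
  then have "y * a ^ (k + m + 1) = (y * a ^ (k + 1)) * a ^ m"
    by (simp only: mult.assoc)
  also have "\<dots> = a ^ (k + m)"
    unfolding assms(1) by (rule power_add [symmetric])
  finally show "y * a ^ (k + m + 1) = a ^ (k + m)" .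
  have "star (a ^ (k + m)) = star (a ^ m) * star (a ^ k)"
    by (simp only: power_add star_mult)
  then show "star (a ^ (k + m)) * a * y = star (a ^ (k + m))"
    using assms(2) by (simp add: mult.assoc)
qed

theorem is_weak_core_inverse_unique:
  fixes a x y :: "'a::proper_star_ring"
  assumes "is_weak_core_inverse a x" and "is_weak_core_inverse a y"
  shows "x = y"
proof -
  obtain i where i: "x * a ^ (i + 1) = a ^ i" "a * x\<^sup>2 = x" "star (a ^ i) * a * x = star (a ^ i)"
    using assms(1) unfolding is_weak_core_inverse_def by blast
  obtain j where j: "y * a ^ (j + 1) = a ^ j" "a * y\<^sup>2 = y" "star (a ^ j) * a * y = star (a ^ j)"
    using assms(2) unfolding is_weak_core_inverse_def by blast
  define k where "k = i + j"
  have x1: "x * a ^ (k + 1) = a ^ k" and x3: "star (a ^ k) * a * x = star (a ^ k)"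
    using weak_core_exponent_mono [OF i(1,3), of j] by (simp_all only: k_def)
  have y1: "y * a ^ (k + 1) = a ^ k" and y3: "star (a ^ k) * a * y = star (a ^ k)"
    using weak_core_exponent_mono [OF j(1,3), of i] by (simp_all only: k_def add.commute [of j i])
  have absorb: "u * a * v = v"
    if "u * a ^ (k + 1) = a ^ k" "a * v\<^sup>2 = v" for u v
  proof -
    have "u * a * v = u * a * (a ^ k * v ^ (k + 1))"
      by (simp only: weak_core_power_right [OF that(2)])
    also have "\<dots> = u * a ^ (k + 1) * v ^ (k + 1)"
      by (simp add: mult.assoc)
    also have "\<dots> = v"
      by (simp only: that(1) weak_core_power_right [OF that(2)])
    finally show ?thesis .
  qed
  have range: "a * v = a ^ k * (a * v ^ (k + 1))" if "a * v\<^sup>2 = v" for v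
  proof -
    have "a * v = a * (a ^ k * v ^ (k + 1))"
      by (simp only: weak_core_power_right [OF that])
    also have "\<dots> = a ^ k * (a * v ^ (k + 1))"
      by (simp only: mult.assoc [symmetric] power_commutes [of a k])
    finally show ?thesis .
  qed
  define d where "d = a * x - a * y"
  define w where "w = a * x ^ (k + 1) - a * y ^ (k + 1)"
  have "d = a ^ k * w"
    unfolding d_def w_def right_diff_distrib
    using range [OF i(2)] range [OF j(2)] by (simp only:)
  then have "star d * d = star w * (star (a ^ k) * d)"
    by (simp add: star_mult mult.assoc)
  also have "star (a ^ k) * d = 0"
    unfolding d_def using x3 y3 by (simp add: right_diff_distrib mult.assoc)
  finally have "star d * d = 0"
    by simp
  then have "d = 0"
    by (rule star_proper)
  then have "a * x = a * y"
    by (simp add: d_def)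
  then show "x = y"
    using absorb [OF y1 i(2)] absorb [OF y1 j(2)] by (simp add: mult.assoc)
qed

lemma weak_core_inverse_eqI:
  assumes "is_weak_core_inverse a y"
  shows "weak_core_inverse a = y"
  unfolding weak_core_inverse_def
  using assms is_weak_core_inverse_unique by blast

end

theory Submission
  imports Defs
begin

text \<open>
  Write \<open>x\<close> and \<open>y\<close> for weak core inverses of \<open>a\<close> and \<open>b\<close>. The candidate \<open>x + y\<close> works because every
  mixed term in its three defining equations vanishes. Some do so because \<open>x\<close> begins with a factor
  \<open>a\<close>, by \<open>x = a * x\<^sup>2\<close>, so that whatever annihilates \<open>a\<close> from the left also annihilates \<open>x\<close>; this is
  where \<open>a * b = 0 = b * a\<close> enters and gives \<open>a * y = 0 = b * x\<close>. The others need the involution: \<open>x\<close>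
  is an outer inverse of \<open>a\<close>, and \<open>a * x\<close> is a projection, that is, self-adjoint, so
  \<open>x = x * (a * x) = x * star x * star a\<close> also ends with a factor \<open>star a\<close>. Hence
  \<open>star a * b = 0\<close> forces \<open>x * b = 0\<close>. Its adjoint \<open>star b * a = 0\<close> forces \<open>y * a = 0\<close> in the same way.

  The powers of \<open>a + b\<close> split for the same reason, and an exponent that serves \<open>a\<close> and one that
  serves \<open>b\<close> may both be enlarged to their sum. So \<open>x + y\<close> inherits the three equations from \<open>x\<close> and
  \<open>y\<close>, and uniqueness of weak core inverses turns this into the equation between the inverses.
\<close>

lemma star_zero: "star (0::'a::proper_star_ring) = 0"
  using star_add [of 0 "0::'a"] by simp

lemma star_mult_zero_sym:
  fixes a b :: "'a::proper_star_ring"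
  assumes "star a * b = 0"
  shows "star b * a = 0"
  using arg_cong [OF assms, of star] by (simp add: star_mult star_star star_zero)

text \<open>The identity \<open>x = a ^ k * x ^ (k + 1)\<close> places a power of \<open>a\<close> next to \<open>x * a\<close> that is high
  enough for \<open>x\<close> to cancel one factor \<open>a\<close>.\<close>

lemma weak_core_inverse_outer:
  fixes a x :: "'a::proper_star_ring"
  assumes "is_weak_core_inverse a x"
  shows "x * a * x = x"
proof -
  obtain k where k: "x * a ^ (k + 1) = a ^ k" "a * x\<^sup>2 = x"
    using assms unfolding is_weak_core_inverse_def by blast
  have "x * a * x = x * a * (a ^ k * x ^ (k + 1))"
    by (simp only: weak_core_power_right [OF k(2)])
  also have "\<dots> = x * a ^ (k + 1) * x ^ (k + 1)"
    by (simp add: mult.assoc)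
  also have "\<dots> = x"
    by (simp only: k(1) weak_core_power_right [OF k(2)])
  finally show ?thesis .
qed

text \<open>The element \<open>p = a * x\<close> lies in the right ideal generated by \<open>a ^ k\<close>, and
  \<open>star (a ^ k) * p = star (a ^ k)\<close>. Hence \<open>star p * p = star p\<close>, whose left-hand side is
  self-adjoint.\<close>

lemma weak_core_inverse_projection:
  fixes a x :: "'a::proper_star_ring"
  assumes "is_weak_core_inverse a x"
  shows "star (a * x) = a * x"
proof -
  obtain k where k: "a * x\<^sup>2 = x" "star (a ^ k) * a * x = star (a ^ k)"
    using assms unfolding is_weak_core_inverse_def by blast
  define p where "p = a * x"
  define w where "w = a * x ^ (k + 1)"
  have "p = a * (a ^ k * x ^ (k + 1))"
    by (simp only: p_def weak_core_power_right [OF k(1)])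
  also have "\<dots> = a ^ k * w"
    by (simp only: w_def mult.assoc [symmetric] power_commutes [of a k])
  finally have star_p: "star p = star w * star (a ^ k)"
    by (simp only: star_mult)
  then have "star p * p = star w * (star (a ^ k) * a * x)"
    by (simp add: p_def mult.assoc)
  then have "star p * p = star p"
    by (simp only: k(2) star_p)
  then have "p = star p"
    by (metis star_mult star_star)
  then show ?thesis
    by (simp add: p_def)
qed

lemma weak_core_inverse_right_zero:
  fixes a b x :: "'a::proper_star_ring"
  assumes "is_weak_core_inverse a x" and "b * a = 0"
  shows "b * x = 0"
proof -
  have "a * x\<^sup>2 = x"
    using assms(1) unfolding is_weak_core_inverse_def by blast
  then have "b * x = (b * a) * x\<^sup>2"
    by (simp only: mult.assoc)
  then show ?thesis
    by (simp add: assms(2))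
qed

text \<open>Although \<open>x\<close> need not end with a factor \<open>a\<close>, the projection \<open>a * x = star x * star a\<close> lets it
  end with \<open>star a\<close>.\<close>

lemma weak_core_inverse_left_zero:
  fixes a b x :: "'a::proper_star_ring"
  assumes "is_weak_core_inverse a x" and "star a * b = 0"
  shows "x * b = 0"
proof -
  have "x = x * (a * x)"
    using weak_core_inverse_outer [OF assms(1)] by (simp add: mult.assoc)
  also have "\<dots> = x * (star x * star a)"
    using weak_core_inverse_projection [OF assms(1)] by (simp only: star_mult)
  finally have "x * b = x * (star x * star a) * b"
    by (rule arg_cong)
  also have "\<dots> = x * star x * (star a * b)"
    by (simp only: mult.assoc)
  finally show ?thesis
    by (simp add: assms(2))
qed

lemma power_add_orthogonal:
  fixes a b :: "'a::ring_1"
  assumes "a * b = 0" and "b * a = 0" and "n > 0"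
  shows "(a + b) ^ n = a ^ n + b ^ n"
  using assms(3)
proof (induction n rule: nat_induct_non_zero)
  case 1
  show ?case by simp
next
  case (Suc n)
  then obtain m where m: "n = Suc m"
    using gr0_implies_Suc by blast
  have "a * b ^ n = 0" "b * a ^ n = 0"
    by (simp_all add: m mult.assoc [symmetric] assms(1,2))
  then show ?case
    using Suc.IH by (simp add: distrib_left distrib_right)
qed

lemma star_power_mult_zero:
  fixes a b :: "'a::proper_star_ring"
  assumes "star a * b = 0" and "n > 0"
  shows "star (a ^ n) * b = 0"
proof -
  obtain m where "n = Suc m"
    using assms(2) gr0_implies_Suc by blast
  then show ?thesis
    by (simp add: star_mult mult.assoc assms(1))
qed

lemma is_weak_core_inverse_add:
  fixes a b x y :: "'a::proper_star_ring"
  assumes x: "is_weak_core_inverse a x" and y: "is_weak_core_inverse b y"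
    and ab: "a * b = 0" and ba: "b * a = 0" and sab: "star a * b = 0"
  shows "is_weak_core_inverse (a + b) (x + y)"
proof -
  obtain i where i: "i > 0" "x * a ^ (i + 1) = a ^ i" "a * x\<^sup>2 = x"
      "star (a ^ i) * a * x = star (a ^ i)"
    using x unfolding is_weak_core_inverse_def by blast
  obtain j where j: "y * b ^ (j + 1) = b ^ j" "b * y\<^sup>2 = y"
      "star (b ^ j) * b * y = star (b ^ j)"
    using y unfolding is_weak_core_inverse_def by blast
  define k where "k = i + j"
  have k: "k > 0"
    using i(1) by (simp add: k_def)
  have xa: "x * a ^ (k + 1) = a ^ k" and ax: "star (a ^ k) * a * x = star (a ^ k)"
    using weak_core_exponent_mono [OF i(2,4), of j] by (simp_all only: k_def)
  have yb: "y * b ^ (k + 1) = b ^ k" and byb: "star (b ^ k) * b * y = star (b ^ k)"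
    using weak_core_exponent_mono [OF j(1,3), of i] by (simp_all only: k_def add.commute [of j i])
  have sba: "star b * a = 0"
    using sab by (rule star_mult_zero_sym)
  have ay0: "a * y = 0" and bx0: "b * x = 0"
    using weak_core_inverse_right_zero [OF y ab] weak_core_inverse_right_zero [OF x ba] by auto
  have xb0: "x * b = 0" and ya0: "y * a = 0"
    using weak_core_inverse_left_zero [OF x sab] weak_core_inverse_left_zero [OF y sba] by auto
  have xy0: "x * y = 0" and yx0: "y * x = 0"
    using weak_core_inverse_right_zero [OF y xb0] weak_core_inverse_right_zero [OF x ya0] by auto
  have pow: "(a + b) ^ n = a ^ n + b ^ n" if "n > 0" for n
    using power_add_orthogonal [OF ab ba that] .
  have prod: "(a + b) * (x + y) = a * x + b * y"
    by (simp add: distrib_left distrib_right ay0 bx0)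

  have "x * b ^ (k + 1) = 0" "y * a ^ (k + 1) = 0"
    by (simp_all add: mult.assoc [symmetric] xb0 ya0)
  then have "(x + y) * (a ^ (k + 1) + b ^ (k + 1)) = a ^ k + b ^ k"
    by (simp only: distrib_left distrib_right xa yb add_0_left add_0_right)
  then have 1: "(x + y) * (a + b) ^ (k + 1) = (a + b) ^ k"
    using pow [of "k + 1"] pow [OF k] by simp

  have "(x + y)\<^sup>2 = x\<^sup>2 + y\<^sup>2"
    using power_add_orthogonal [OF xy0 yx0, of 2] by simp
  moreover have "a * y\<^sup>2 = 0" "b * x\<^sup>2 = 0"
    by (simp_all add: power2_eq_square mult.assoc [symmetric] ay0 bx0)
  ultimately have 2: "(a + b) * (x + y)\<^sup>2 = x + y"
    by (simp add: distrib_left distrib_right i(3) j(2))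

  have "star (a ^ k) * (b * y) = 0" "star (b ^ k) * (a * x) = 0"
    using star_power_mult_zero [OF sab k] star_power_mult_zero [OF sba k]
    by (simp_all add: mult.assoc [symmetric])
  then have "star ((a + b) ^ k) * ((a + b) * (x + y)) = star ((a + b) ^ k)"
    unfolding prod pow [OF k] star_add
    using ax byb by (simp add: distrib_left distrib_right mult.assoc)
  then have 3: "star ((a + b) ^ k) * (a + b) * (x + y) = star ((a + b) ^ k)"
    by (simp only: mult.assoc)

  show ?thesis
    unfolding is_weak_core_inverse_def using k 1 2 3 by blast
qed

theorem theorem3p22:
  fixes a b :: "'a::proper_star_ring"
  assumes "weak_core_invertible a" and "weak_core_invertible b"
    and "a * b = 0" and "b * a = 0" and "star a * b = 0"
  shows "weak_core_invertible (a + b) \<and>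
    weak_core_inverse (a + b) = weak_core_inverse a + weak_core_inverse b"
proof -
  obtain x y where x: "is_weak_core_inverse a x" and y: "is_weak_core_inverse b y"
    using assms(1,2) unfolding weak_core_invertible_def by blast
  have sum: "is_weak_core_inverse (a + b) (x + y)"
    using x y assms(3-5) by (rule is_weak_core_inverse_add)
  then have "weak_core_invertible (a + b)"
    unfolding weak_core_invertible_def by blast
  with sum x y show ?thesis
    by (simp add: weak_core_inverse_eqI)
qed

end
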